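(* Let $R$ be a commutative ring and $G$ a torsion-free abelian group (written additively). Then the units of the group-ring $R[G]$ are precisely the elements $f=\sum_{x\in G}r_x\epsilon_x$ (finite sum, $r_x\in R$) such that the ideal $(r_x: x\in G)$ of $R$ equals $R$ and $r_xr_y$ is nilpotent for all $x\neq y$ in $G$.
   Context: Rings have an identity. $R[G]$ is the free $R$-module with basis $\{\epsilon_x: x\in G\}$ and multiplication determined $R$-bilinearly by $\epsilon_x\epsilon_y=\epsilon_{x+y}$; its identity is $\epsilon_0$. *)

theory Defs
  imports "HOL-Library.Poly_Mapping"
begin

text \<open>
  The group ring of \<open>G\<close> over \<open>R\<close> is the type \<open>'g \<Rightarrow>\<^sub>0 'r\<close> of finitely supported functions with its
  convolution product: \<open>Poly_Mapping.single x 1\<close> is the basis element of \<open>x\<close>, and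
  \<open>Poly_Mapping.lookup f x\<close> is the coefficient of \<open>f\<close> at \<open>x\<close>.

  The coefficients have sort \<open>{comm_ring, monoid_mult}\<close> (commutative rings with an identity)
  and not \<open>comm_ring_1\<close>, because the latter excludes the zero ring. On this
  sort the constant \<open>1\<close> of type \<open>'g \<Rightarrow>\<^sub>0 'r\<close> is not available, so the identity of the group ring is
  written as the basis element of \<open>0\<close>.
\<close>

definition group_ring_one :: "('g::ab_group_add) \<Rightarrow>\<^sub>0 ('r::{comm_ring,monoid_mult})" where
  "group_ring_one = Poly_Mapping.single 0 1"

lemma sum_single_lookup:
  "f = (\<Sum>x\<in>Poly_Mapping.keys f. Poly_Mapping.single x (Poly_Mapping.lookup f x))"
  by (rule poly_mapping_eqI) (simp add: lookup_sum lookup_single when_def in_keys_iff)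

lemma group_ring_one_mult [simp]: "group_ring_one * f = f"
proof -
  have "group_ring_one * f =
      (\<Sum>x\<in>Poly_Mapping.keys f. group_ring_one * Poly_Mapping.single x (Poly_Mapping.lookup f x))"
    by (subst sum_single_lookup [of f]) (simp only: sum_distrib_left)
  also have "\<dots> = f"
    by (simp add: group_ring_one_def mult_single flip: sum_single_lookup)
  finally show ?thesis .
qed

lemma mult_group_ring_one [simp]: "f * group_ring_one = f"
  by (metis group_ring_one_mult mult.commute)

definition group_ring_units :: "(('g::ab_group_add) \<Rightarrow>\<^sub>0 ('r::{comm_ring,monoid_mult})) set" where
  "group_ring_units = {f. \<exists>g. f * g = group_ring_one \<and> g * f = group_ring_one}"

definition is_ideal :: "('r::{comm_ring,monoid_mult}) set \<Rightarrow> bool" where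
  "is_ideal I \<longleftrightarrow> 0 \<in> I \<and> (\<forall>a\<in>I. \<forall>b\<in>I. a + b \<in> I) \<and> (\<forall>r. \<forall>a\<in>I. r * a \<in> I)"

definition ideal_generated_by :: "('r::{comm_ring,monoid_mult}) set \<Rightarrow> 'r set" where
  "ideal_generated_by S = \<Inter>{I. is_ideal I \<and> S \<subseteq> I}"

definition nilpotent :: "('r::{comm_ring,monoid_mult}) \<Rightarrow> bool" where
  "nilpotent a \<longleftrightarrow> (\<exists>n. a ^ n = 0)"

text \<open>The sum below is the multiple \<open>n \<cdot> x\<close>.\<close>

definition torsion_free :: "('g::ab_group_add) itself \<Rightarrow> bool" where
  "torsion_free _ \<longleftrightarrow> (\<forall>(x::'g) n::nat. n > 0 \<longrightarrow> (\<Sum>i<n. x) = 0 \<longrightarrow> x = 0)"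

end

theory Submission
  imports Defs
begin

text \<open>
  A torsion-free abelian group carries a compatible total order. If \<open>f * g = 1\<close>, descending
  induction on \<open>z > 0\<close> (and, with the order reversed, on \<open>z < 0\<close>) shows that \<open>f\<^sub>x g\<^sub>y\<close> is nilpotent
  whenever \<open>x + y = z\<close>: multiply the coefficient \<open>\<Sum> f\<^sub>u g\<^sub>v = 0\<close> at \<open>z\<close> by \<open>f\<^sub>x g\<^sub>y\<close>; for
  \<open>u \<noteq> x\<close> one of \<open>u + y\<close> and \<open>x + v\<close> exceeds \<open>z\<close>, so \<open>(f\<^sub>x g\<^sub>y)\<^sup>2\<close> is nilpotent. Then
  \<open>f\<^sub>x f\<^sub>y = \<Sum> f\<^sub>x f\<^sub>y f\<^sub>u g\<^bsub>-u\<^esub>\<close> is nilpotent for \<open>x \<noteq> y\<close>.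

  Conversely, if \<open>1 = \<Sum> a\<^sub>x f\<^sub>x\<close>, then modulo nilpotents the \<open>a\<^sub>x f\<^sub>x\<close> are orthogonal idempotents
  with sum \<open>1\<close>, and \<open>\<Sum> a\<^sub>x\<^sup>2 f\<^sub>x \<epsilon>\<^bsub>-x\<^esub>\<close> is an inverse of \<open>f\<close>.
\<close>

section \<open>Nilpotent elements\<close>

lemma nilpotent_zero [simp]: "nilpotent 0"
  unfolding nilpotent_def by (metis power_one_right)

lemma nilpotent_mult:
  assumes "nilpotent a"
  shows "nilpotent (r * a)"
proof -
  have "(r * a) ^ n = r ^ n * a ^ n" for n
    by (induction n) (simp_all add: ac_simps)
  then show ?thesis
    using assms unfolding nilpotent_def by (metis mult_zero_right)
qed

lemma nilpotent_mult': "nilpotent a \<Longrightarrow> nilpotent (a * r)"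
  using nilpotent_mult [of a r] by (simp add: mult.commute)

text \<open>The binomial theorem of the library needs \<open>0 \<noteq> 1\<close>, which the sort does not provide.\<close>

lemma mult_power_add_eq_0:
  fixes a b c :: "'r::{comm_ring,monoid_mult}"
  assumes "c * a ^ m = 0" "c * b ^ n = 0"
  shows "c * (a + b) ^ (m + n) = 0"
  using assms
proof (induction "m + n" arbitrary: c m n)
  case 0
  then show ?case by simp
next
  case (Suc k)
  show ?case
  proof (cases "m = 0 \<or> n = 0")
    case True
    then show ?thesis using Suc.prems by auto
  next
    case False
    then obtain m' n' where mn: "m = Suc m'" "n = Suc n'"
      by (metis not0_implies_Suc)
    \<comment> \<open>One factor of \<open>(a + b) ^ Suc k\<close> splits into \<open>a\<close> and
      \<open>b\<close>, absorbed into \<open>c\<close>: \<open>c * a\<close> is killed by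
      \<open>a ^ m'\<close> and \<open>b ^ n\<close>, and \<open>c * b\<close> by
      \<open>a ^ m\<close> and \<open>b ^ n'\<close>. Both pairs of exponents sum to
      \<open>k\<close>.\<close>
    have "(c * a) * a ^ m' = 0" "(c * b) * b ^ n' = 0"
      using Suc.prems mn by (simp_all add: mult.assoc)
    moreover have "(c * a) * b ^ n = 0" "(c * b) * a ^ m = 0"
      using Suc.prems by (metis mult.assoc mult.commute mult_zero_right)+
    moreover have k: "k = m' + n" "k = m + n'" "m + n = Suc k"
      using mn Suc.hyps(2) by auto
    ultimately have "(c * a) * (a + b) ^ k = 0" "(c * b) * (a + b) ^ k = 0"
      using Suc.hyps(1) [OF k(1)] Suc.hyps(1) [OF k(2)] Suc.prems k
      by (metis mult.assoc mult.commute)+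
    with k show ?thesis
      by (simp only: power_Suc) (simp add: distrib_left distrib_right flip: mult.assoc)
  qed
qed

lemma nilpotent_add:
  assumes "nilpotent a" "nilpotent b"
  shows "nilpotent (a + b)"
proof -
  from assms obtain m n where "a ^ m = 0" "b ^ n = 0"
    unfolding nilpotent_def by blast
  then show ?thesis
    using mult_power_add_eq_0 [of 1 a m b n] unfolding nilpotent_def by auto
qed

lemma nilpotent_minus: "nilpotent a \<Longrightarrow> nilpotent (- a)"
  using nilpotent_mult [of a "- 1"] by simp

lemma nilpotent_sum: "(\<And>x. x \<in> A \<Longrightarrow> nilpotent (f x)) \<Longrightarrow> nilpotent (sum f A)"
  by (induction A rule: infinite_finite_induct) (auto intro: nilpotent_add)

lemma nilpotent_square: "nilpotent (a * a) \<Longrightarrow> nilpotent a"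
  unfolding nilpotent_def by (metis power2_eq_square power_mult)

text \<open>Multiplying the whole sum by \<open>s x\<close> leaves the square of \<open>s x\<close>
  plus nilpotent cross terms.\<close>

lemma nilpotent_summand:
  fixes s :: "'a \<Rightarrow> 'r::{comm_ring,monoid_mult}"
  assumes "finite A" "x \<in> A" "nilpotent (sum s A)"
    and "\<And>y. y \<in> A \<Longrightarrow> y \<noteq> x \<Longrightarrow> nilpotent (s y * s x)"
  shows "nilpotent (s x)"
proof -
  have "s x * s x = sum s A * s x + - (\<Sum>y\<in>A - {x}. s y * s x)"
    using assms(1,2) by (simp add: sum.remove [of A x] sum_distrib_right distrib_right)
  also have "nilpotent \<dots>"
    by (rule nilpotent_add [OF nilpotent_mult' nilpotent_minus [OF nilpotent_sum]])
      (use assms(3,4) in auto)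
  finally show ?thesis by (rule nilpotent_square)
qed

section \<open>Ordering torsion-free abelian groups\<close>

text \<open>The nonnegative elements of a translation-invariant partial order, \<open>y\<close>
  being at least \<open>x\<close> when \<open>y - x \<in> P\<close>. Totality is stated separately
  where needed.\<close>

definition pos_cone :: "'g::ab_group_add set \<Rightarrow> bool" where
  "pos_cone P \<longleftrightarrow> 0 \<in> P \<and> (\<forall>x\<in>P. \<forall>y\<in>P. x + y \<in> P) \<and> (\<forall>x\<in>P. - x \<in> P \<longrightarrow> x = 0)"

abbreviation nsmul :: "nat \<Rightarrow> 'g::ab_group_add \<Rightarrow> 'g" where
  "nsmul n x \<equiv> (\<Sum>i<n. x)"

lemma nsmul_add: "nsmul (m + n) x = nsmul m x + nsmul n x"
  by (induction n) (simp_all add: ac_simps)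

lemma nsmul_mult: "nsmul (m * n) x = nsmul m (nsmul n x)"
  by (induction m) (simp_all add: nsmul_add ac_simps)

lemma nsmul_mem_cone: "pos_cone P \<Longrightarrow> x \<in> P \<Longrightarrow> nsmul n x \<in> P"
  by (induction n) (auto simp: pos_cone_def)

text \<open>This extends the order so that \<open>x\<close> becomes nonnegative. Antisymmetry
  survives: if \<open>w\<close> and \<open>- w\<close> both lie in the new set, their sum puts some
  \<open>- nsmul (n + m) x\<close> into \<open>P\<close>, which forces
  \<open>n = m = 0\<close>.\<close>

lemma pos_cone_adjoin:
  assumes P: "pos_cone P" and no: "\<And>k. k > 0 \<Longrightarrow> - nsmul k x \<notin> P"
  shows "pos_cone {p + nsmul n x |p n. p \<in> P}"
  unfolding pos_cone_def
proof (intro conjI ballI impI)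
  show "0 \<in> {p + nsmul n x |p n. p \<in> P}"
    using P by (intro CollectI exI [of _ 0] exI [of _ "0::nat"]) (auto simp: pos_cone_def)
next
  fix v w
  assume "v \<in> {p + nsmul n x |p n. p \<in> P}" "w \<in> {p + nsmul n x |p n. p \<in> P}"
  then obtain p n q m where "v = p + nsmul n x" "w = q + nsmul m x" "p \<in> P" "q \<in> P"
    by blast
  moreover from this have "v + w = (p + q) + nsmul (n + m) x"
    by (simp only: nsmul_add) (simp add: ac_simps)
  ultimately show "v + w \<in> {p + nsmul n x |p n. p \<in> P}"
    using P unfolding pos_cone_def by blast
next
  fix w
  assume "w \<in> {p + nsmul n x |p n. p \<in> P}" "- w \<in> {p + nsmul n x |p n. p \<in> P}"
  then obtain p n q m where w: "w = p + nsmul n x" "- w = q + nsmul m x" "p \<in> P" "q \<in> P"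
    by blast
  have "(p + q) + nsmul (n + m) x = w + - w"
    unfolding w(2) unfolding w(1) by (simp only: nsmul_add) (simp add: ac_simps)
  then have eq: "- nsmul (n + m) x = p + q"
    by (simp add: eq_neg_iff_add_eq_0 neg_eq_iff_add_eq_0 add.commute)
  have "p + q \<in> P"
    using P w by (auto simp: pos_cone_def)
  then have "n + m = 0"
    using no [of "n + m"] eq by (metis gr0I)
  then have "w = p" "- w = q"
    using w by auto
  then show "w = 0"
    using P w by (auto simp: pos_cone_def)
qed

text \<open>Zorn's lemma yields a maximal cone, and maximality together with torsion-freeness makes
  it total.\<close>

lemma torsion_free_total_cone:
  assumes tf: "torsion_free TYPE('g::ab_group_add)"
  obtains P :: "'g::ab_group_add set" where "pos_cone P" "\<And>x. x \<in> P \<or> - x \<in> P"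
proof -
  have "\<exists>M\<in>{P :: 'g set. pos_cone P}. \<forall>X\<in>{P. pos_cone P}. M \<subseteq> X \<longrightarrow> X = M"
  proof (rule subset_Zorn_nonempty)
    show "{P :: 'g set. pos_cone P} \<noteq> {}"
    proof -
      have "pos_cone {0 :: 'g}" by (simp add: pos_cone_def)
      then show ?thesis by blast
    qed
  next
    fix C :: "'g set set"
    assume ne: "C \<noteq> {}" and ch: "subset.chain {P. pos_cone P} C"
    have cone: "pos_cone P" if "P \<in> C" for P
      using ch that by (auto simp: subset.chain_def)
    have two: "\<exists>P\<in>C. x \<in> P \<and> y \<in> P" if "x \<in> \<Union>C" "y \<in> \<Union>C" for x y
      using ch that unfolding subset_chain_def by blast
    have "pos_cone (\<Union>C)"
      unfolding pos_cone_def
    proof (intro conjI ballI impI)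
      show "0 \<in> \<Union>C"
        using ne cone by (auto simp: pos_cone_def)
    next
      fix x y
      assume "x \<in> \<Union>C" "y \<in> \<Union>C"
      then show "x + y \<in> \<Union>C"
        using two [of x y] cone by (auto simp: pos_cone_def)
    next
      fix x
      assume "x \<in> \<Union>C" "- x \<in> \<Union>C"
      then show "x = 0"
        using two [of x "- x"] cone by (auto simp: pos_cone_def)
    qed
    then show "\<Union>C \<in> {P. pos_cone P}" by simp
  qed
  then obtain P :: "'g set" where P: "pos_cone P"
    and max: "\<And>X. pos_cone X \<Longrightarrow> P \<subseteq> X \<Longrightarrow> X = P"
    by auto
  \<comment> \<open>Otherwise \<open>x\<close> could be adjoined to \<open>P\<close>, against
    maximality.\<close>
  have neg: "\<exists>k>0. - nsmul k x \<in> P" if "x \<notin> P" for x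
  proof (rule ccontr)
    let ?Q = "{p + nsmul n x |p n. p \<in> P}"
    assume "\<not> ?thesis"
    then have "pos_cone ?Q"
      using P by (intro pos_cone_adjoin) blast+
    moreover have "P \<subseteq> ?Q"
    proof
      fix p
      assume "p \<in> P"
      then show "p \<in> ?Q"
        by (intro CollectI exI [of _ p] exI [of _ "0::nat"]) simp
    qed
    ultimately have "?Q = P"
      by (rule max)
    moreover have "0 + nsmul 1 x \<in> ?Q"
      using P unfolding pos_cone_def by blast
    ultimately show False
      using that by auto
  qed
  have "x \<in> P \<or> - x \<in> P" for x
  proof (rule ccontr)
    assume *: "\<not> ?thesis"
    then obtain k l where kl: "k > 0" "l > 0" "- nsmul k x \<in> P" "- nsmul l (- x) \<in> P"
      using neg [of x] neg [of "- x"] by blast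
    have neg_mult: "- nsmul n y = nsmul n (- y)" for n and y :: 'g
      by (rule sum_negf [symmetric])
    \<comment> \<open>The common multiple \<open>l * k\<close> puts both
      \<open>nsmul (l * k) x\<close> and its negative into \<open>P\<close>, so it vanishes.\<close>
    have "- nsmul (l * k) x = nsmul l (- nsmul k x)"
      by (simp only: nsmul_mult neg_mult)
    then have "- nsmul (l * k) x \<in> P"
      using nsmul_mem_cone [OF P kl(3), of l] by (simp only:)
    moreover have "nsmul (l * k) x = nsmul k (- nsmul l (- x))"
      by (simp only: mult.commute [of l k] nsmul_mult neg_mult minus_minus)
    then have "nsmul (l * k) x \<in> P"
      using nsmul_mem_cone [OF P kl(4), of k] by (simp only:)
    ultimately have "nsmul (l * k) x = 0"
      using P unfolding pos_cone_def by blast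
    then have "x = 0"
      using tf kl unfolding torsion_free_def by (metis nat_0_less_mult_iff)
    then show False
      using * P by (auto simp: pos_cone_def)
  qed
  then show thesis
    using P that by blast
qed

section \<open>Coefficients of products and units\<close>

lemma lookup_single_mult:
  fixes f :: "'g::ab_group_add \<Rightarrow>\<^sub>0 'r::{comm_ring,monoid_mult}"
  shows "Poly_Mapping.lookup (Poly_Mapping.single x a * f) k = a * Poly_Mapping.lookup f (k - x)"
proof -
  have "Poly_Mapping.lookup (Poly_Mapping.single x a * f) k =
      (\<Sum>y\<in>Poly_Mapping.keys f. a * Poly_Mapping.lookup f y when x + y = k)"
    by (subst sum_single_lookup [of f])
      (simp add: sum_distrib_left mult_single lookup_sum lookup_single)
  also have "\<dots> = (\<Sum>y\<in>Poly_Mapping.keys f. if y = k - x then a * Poly_Mapping.lookup f y else 0)"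
    by (rule sum.cong) (auto simp: when_def algebra_simps)
  also have "\<dots> = a * Poly_Mapping.lookup f (k - x)"
    by (simp add: in_keys_iff)
  finally show ?thesis .
qed

lemma lookup_mult_sum:
  fixes f g :: "'g::ab_group_add \<Rightarrow>\<^sub>0 'r::{comm_ring,monoid_mult}"
  shows "Poly_Mapping.lookup (f * g) k =
    (\<Sum>x\<in>Poly_Mapping.keys f. Poly_Mapping.lookup f x * Poly_Mapping.lookup g (k - x))"
  by (subst sum_single_lookup [of f]) (simp add: sum_distrib_right lookup_sum lookup_single_mult)

lemma group_ring_unitsI: "f * g = group_ring_one \<Longrightarrow> f \<in> group_ring_units"
  unfolding group_ring_units_def by (auto simp: mult.commute)

lemma group_ring_units_mult_iff:
  "u * v \<in> group_ring_units \<longleftrightarrow> u \<in> group_ring_units \<and> v \<in> group_ring_units"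
proof
  assume "u * v \<in> group_ring_units"
  then obtain w where "u * v * w = group_ring_one"
    unfolding group_ring_units_def by blast
  then have "u * (v * w) = group_ring_one" "v * (u * w) = group_ring_one"
    by (simp_all add: ac_simps)
  then show "u \<in> group_ring_units \<and> v \<in> group_ring_units"
    by (blast intro: group_ring_unitsI)
next
  assume "u \<in> group_ring_units \<and> v \<in> group_ring_units"
  then obtain u' v' where "u * u' = group_ring_one" "v * v' = group_ring_one"
    unfolding group_ring_units_def by blast
  then have "(u * v) * (u' * v') = group_ring_one"
    by (metis mult.assoc mult.left_commute mult_group_ring_one)
  then show "u * v \<in> group_ring_units"
    by (rule group_ring_unitsI)
qed

lemma group_ring_one_unit: "group_ring_one \<in> group_ring_units"
  by (rule group_ring_unitsI) (rule group_ring_one_mult)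

text \<open>Induction on the exponent via \<open>(1 + t) (1 - t) = 1 - t\<^sup>2\<close>.\<close>

lemma one_plus_nilpotent_unit:
  fixes h :: "'g::ab_group_add \<Rightarrow>\<^sub>0 'r::{comm_ring,monoid_mult}"
  assumes "a ^ n = 0"
  shows "group_ring_one + Poly_Mapping.single x a * h \<in> group_ring_units"
  using assms
proof (induction n arbitrary: a x h)
  case 0
  \<comment> \<open>Here \<open>a ^ 0 = 0\<close> says \<open>1 = 0\<close>, so the coefficient ring
    is zero.\<close>
  then have "(r::'r) = 0" for r
    by (metis mult_1_left mult_zero_left power_0)
  then have "a = 0" .
  then show ?case by (simp add: group_ring_one_unit)
next
  case (Suc n)
  show ?case
  proof (cases n)
    case 0
    then have "a = 0" using Suc.prems by simp
    then show ?thesis by (simp add: group_ring_one_unit)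
  next
    case (Suc m)
    let ?t = "Poly_Mapping.single x a * h"
    \<comment> \<open>The exponents agree, \<open>2 * n = Suc n + m\<close>, because
      \<open>n = Suc m\<close>; so squaring \<open>a\<close> lowers the exponent that kills it from
      \<open>Suc n\<close> to \<open>n\<close>. The free factor \<open>h\<close> keeps the square of
      \<open>?t\<close> in the shape required by the induction hypothesis.\<close>
    have "(a * a) ^ n = a ^ Suc n * a ^ m"
      by (simp only: power2_eq_square [symmetric] power_mult [symmetric] power_add [symmetric])
        (simp add: Suc mult_2)
    then have "(a * a) ^ n = 0"
      using Suc.prems by simp
    then have "group_ring_one + Poly_Mapping.single (x + x) (a * a) * (- (h * h)) \<in> group_ring_units"
      by (rule Suc.IH)
    also have "group_ring_one + Poly_Mapping.single (x + x) (a * a) * (- (h * h)) =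
        group_ring_one - ?t * ?t"
      by (simp add: ac_simps flip: mult_single)
    also have "\<dots> = (group_ring_one + ?t) * (group_ring_one - ?t)"
      by (simp add: ring_distribs)
    finally show ?thesis
      by (simp add: group_ring_units_mult_iff)
  qed
qed

text \<open>Factor out \<open>u\<close>: its inverse goes into the free factor \<open>h\<close> of
  the preceding lemma.\<close>

lemma unit_plus_single_nilpotent:
  assumes "u \<in> group_ring_units" "nilpotent a"
  shows "u + Poly_Mapping.single x a \<in> group_ring_units"
proof -
  obtain v where v: "u * v = group_ring_one"
    using assms(1) unfolding group_ring_units_def by blast
  have "u * (group_ring_one + Poly_Mapping.single x a * v) \<in> group_ring_units"
    using assms one_plus_nilpotent_unit unfolding nilpotent_def
    by (auto simp: group_ring_units_mult_iff)
  also have "u * (group_ring_one + Poly_Mapping.single x a * v) = u + Poly_Mapping.single x a * (u * v)"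
    by (simp add: distrib_left ac_simps)
  finally show ?thesis by (simp add: v)
qed

lemma one_plus_nilpotent_coeffs_unit:
  assumes "\<And>x. nilpotent (Poly_Mapping.lookup d x)"
  shows "group_ring_one + d \<in> group_ring_units"
proof -
  have "finite A \<Longrightarrow>
      group_ring_one + (\<Sum>x\<in>A. Poly_Mapping.single x (Poly_Mapping.lookup d x)) \<in> group_ring_units" for A
  proof (induction rule: finite_induct)
    case empty
    then show ?case by (simp add: group_ring_one_unit)
  next
    case (insert x A)
    then show ?case
      using unit_plus_single_nilpotent [OF insert.IH assms [of x], of x] by (simp add: ac_simps)
  qed
  from this [of "Poly_Mapping.keys d"] show ?thesis
    by (simp flip: sum_single_lookup)
qed

section \<open>The coefficients of a unit\<close>

lemma nilpotent_coeffs_if_positive: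
  fixes f g :: "'g::ab_group_add \<Rightarrow>\<^sub>0 'r::{comm_ring,monoid_mult}"
  assumes P: "pos_cone P" and total: "\<And>x. x \<in> P \<or> - x \<in> P"
    and fg: "\<And>z. z \<in> P \<Longrightarrow> z \<noteq> 0 \<Longrightarrow> nilpotent (Poly_Mapping.lookup (f * g) z)"
    and z: "x + y \<in> P" "x + y \<noteq> 0"
  shows "nilpotent (Poly_Mapping.lookup f x * Poly_Mapping.lookup g y)"
proof -
  let ?r = "Poly_Mapping.lookup f" and ?s = "Poly_Mapping.lookup g"
  define Z where "Z = (\<lambda>(x, y). x + y) ` (Poly_Mapping.keys f \<times> Poly_Mapping.keys g)"
  have fin: "finite Z" by (simp add: Z_def)
  have P_add: "v + w \<in> P" if "v \<in> P" "w \<in> P" for v w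
    using P that by (auto simp: pos_cone_def)
  have P_anti: "v = 0" if "v \<in> P" "- v \<in> P" for v
    using P that by (auto simp: pos_cone_def)
  show ?thesis
    using z
  \<comment> \<open>The measure counts the elements of the finite set \<open>Z\<close> that are at
    least \<open>x + y\<close>. It drops strictly when the sum increases, provided that the old sum
    lies in \<open>Z\<close>, which holds when both coefficients are nonzero.\<close>
  proof (induction "card {w \<in> Z. w - (x + y) \<in> P}" arbitrary: x y rule: less_induct)
    case less
    define z where "z = x + y"
    show ?case
    proof (cases "?r x = 0 \<or> ?s y = 0")
      case True
      then show ?thesis by auto
    next
      case False
      then have x: "x \<in> Poly_Mapping.keys f" and "z \<in> Z"
        by (auto simp: Z_def z_def in_keys_iff)
      have above: "nilpotent (?r u * ?s v)" if "u + v - z \<in> P" "u + v \<noteq> z" for u v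
      proof (rule less.hyps)
        have "{w \<in> Z. w - (u + v) \<in> P} \<subseteq> {w \<in> Z. w - z \<in> P}"
          using P_add [OF _ that(1)] by fastforce
        moreover have "z \<in> {w \<in> Z. w - z \<in> P}"
          using \<open>z \<in> Z\<close> P by (auto simp: pos_cone_def)
        moreover have "z \<notin> {w \<in> Z. w - (u + v) \<in> P}"
          using P_anti [OF that(1)] that(2) by auto
        ultimately have "{w \<in> Z. w - (u + v) \<in> P} \<subset> {w \<in> Z. w - z \<in> P}"
          by blast
        then have "card {w \<in> Z. w - (u + v) \<in> P} < card {w \<in> Z. w - z \<in> P}"
          using fin by (intro psubset_card_mono) auto
        then show "card {w \<in> Z. w - (u + v) \<in> P} < card {w \<in> Z. w - (x + y) \<in> P}"
          by (simp only: z_def)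
        show "u + v \<in> P"
          using P_add [OF that(1), of z] less.prems by (simp add: z_def)
        show "u + v \<noteq> 0"
          using P_anti [of z] that(1) less.prems by (auto simp: z_def)
      qed
      have "nilpotent (?r x * ?s (z - x))"
      proof (rule nilpotent_summand [where A = "Poly_Mapping.keys f" and s = "\<lambda>u. ?r u * ?s (z - u)"])
        show "nilpotent (\<Sum>u\<in>Poly_Mapping.keys f. ?r u * ?s (z - u))"
          using fg [of z] less.prems by (simp add: z_def lookup_mult_sum)
      next
        fix u
        assume "u \<noteq> x"
        \<comment> \<open>The index sums \<open>u + (z - x)\<close> and \<open>x + (z - u)\<close>
          differ from \<open>z\<close> by \<open>u - x\<close> and \<open>x - u\<close>; by totality
          one of them lies strictly above \<open>z\<close>.\<close>
        have "nilpotent (?r u * ?s (z - x)) \<or> nilpotent (?r x * ?s (z - u))"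
          using total [of "u - x"] above [of u "z - x"] above [of x "z - u"] \<open>u \<noteq> x\<close>
          by (auto simp: algebra_simps)
        moreover have "?r u * ?s (z - u) * (?r x * ?s (z - x)) =
            (?r u * ?s (z - x)) * (?r x * ?s (z - u))"
          by (simp add: ac_simps)
        ultimately show "nilpotent (?r u * ?s (z - u) * (?r x * ?s (z - x)))"
          by (metis nilpotent_mult nilpotent_mult')
      qed (use x in auto)
      then show ?thesis by (simp add: z_def)
    qed
  qed
qed

lemma nilpotent_coeffs_if_unit:
  fixes f g :: "'g::ab_group_add \<Rightarrow>\<^sub>0 'r::{comm_ring,monoid_mult}"
  assumes tf: "torsion_free TYPE('g)" and fg: "f * g = group_ring_one" and ne: "x + y \<noteq> 0"
  shows "nilpotent (Poly_Mapping.lookup f x * Poly_Mapping.lookup g y)"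
proof -
  obtain P :: "'g set" where P: "pos_cone P" and total: "\<And>x. x \<in> P \<or> - x \<in> P"
    using torsion_free_total_cone [OF tf] by blast
  \<comment> \<open>The reversed order handles the case where \<open>x + y\<close> is
    negative.\<close>
  have Q: "pos_cone (uminus ` P)" "\<And>x. x \<in> uminus ` P \<or> - x \<in> uminus ` P"
  proof -
    have mem: "v \<in> uminus ` P \<longleftrightarrow> - v \<in> P" for v
      by (metis image_eqI imageE minus_minus)
    show "pos_cone (uminus ` P)"
      using P unfolding pos_cone_def Ball_def mem
      by (metis minus_add_distrib minus_minus neg_equal_0_iff_equal)
    show "x \<in> uminus ` P \<or> - x \<in> uminus ` P" for x
      using total [of x] by (auto simp: mem)
  qed
  have c: "nilpotent (Poly_Mapping.lookup (f * g) z)" if "z \<noteq> 0" for z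
    using that by (simp add: fg group_ring_one_def lookup_single)
  show ?thesis
  proof (cases "x + y \<in> P")
    case True
    then show ?thesis
      using nilpotent_coeffs_if_positive [OF P total] c ne by blast
  next
    case False
    then have "x + y \<in> uminus ` P"
      using total [of "x + y"] by (metis image_eqI minus_minus)
    then show ?thesis
      using nilpotent_coeffs_if_positive [OF Q] c ne by blast
  qed
qed

lemma is_ideal_sum: "is_ideal I \<Longrightarrow> (\<And>x. x \<in> A \<Longrightarrow> f x \<in> I) \<Longrightarrow> sum f A \<in> I"
  by (induction A rule: infinite_finite_induct) (auto simp: is_ideal_def)

lemma unit_imp:
  fixes f :: "'g::ab_group_add \<Rightarrow>\<^sub>0 'r::{comm_ring,monoid_mult}"
  assumes tf: "torsion_free TYPE('g)" and "f \<in> group_ring_units"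
  shows "ideal_generated_by (range (Poly_Mapping.lookup f)) = UNIV"
    and "x \<noteq> y \<Longrightarrow> nilpotent (Poly_Mapping.lookup f x * Poly_Mapping.lookup f y)"
proof -
  let ?r = "Poly_Mapping.lookup f"
  obtain g where fg: "f * g = group_ring_one"
    using assms(2) unfolding group_ring_units_def by blast
  have one: "(\<Sum>u\<in>Poly_Mapping.keys f. ?r u * Poly_Mapping.lookup g (- u)) = 1"
    using lookup_mult_sum [of f g 0] by (simp add: fg group_ring_one_def)
  have "r \<in> I" if I: "is_ideal I" "range ?r \<subseteq> I" for I r
  proof -
    have "(\<Sum>u\<in>Poly_Mapping.keys f. Poly_Mapping.lookup g (- u) * ?r u) \<in> I"
      using I by (intro is_ideal_sum) (auto simp: is_ideal_def image_subset_iff)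
    then have "1 \<in> I" using one by (simp add: mult.commute)
    then show ?thesis using I unfolding is_ideal_def by (metis mult_1_right)
  qed
  then show "ideal_generated_by (range ?r) = UNIV"
    unfolding ideal_generated_by_def by blast
  assume "x \<noteq> y"
  have "?r x * ?r y = ?r x * ?r y * (\<Sum>u\<in>Poly_Mapping.keys f. ?r u * Poly_Mapping.lookup g (- u))"
    by (simp add: one)
  also have "\<dots> = (\<Sum>u\<in>Poly_Mapping.keys f. ?r x * ?r y * (?r u * Poly_Mapping.lookup g (- u)))"
    by (simp add: sum_distrib_left)
  also have "nilpotent \<dots>"
  proof (rule nilpotent_sum)
    fix u
    \<comment> \<open>Since \<open>x \<noteq> y\<close>, at least one of \<open>x - u\<close> and
      \<open>y - u\<close> is nonzero.\<close>
    have "nilpotent (?r x * Poly_Mapping.lookup g (- u)) \<or> nilpotent (?r y * Poly_Mapping.lookup g (- u))"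
      using nilpotent_coeffs_if_unit [OF tf fg] \<open>x \<noteq> y\<close>
      by (metis add.right_inverse add_right_cancel)
    moreover have "?r x * ?r y * (?r u * Poly_Mapping.lookup g (- u)) =
        (?r y * ?r u) * (?r x * Poly_Mapping.lookup g (- u))"
      "?r x * ?r y * (?r u * Poly_Mapping.lookup g (- u)) =
        (?r x * ?r u) * (?r y * Poly_Mapping.lookup g (- u))"
      by (simp_all add: ac_simps)
    ultimately show "nilpotent (?r x * ?r y * (?r u * Poly_Mapping.lookup g (- u)))"
      by (metis nilpotent_mult)
  qed
  finally show "nilpotent (?r x * ?r y)" .
qed

section \<open>Inverting elements with coprime coefficients\<close>

text \<open>The linear combinations of the coefficients over the support form an ideal containing
  every coefficient, hence containing \<open>1\<close>.\<close>

lemma ideal_generated_by_lookup_UNIV: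
  fixes f :: "'g::ab_group_add \<Rightarrow>\<^sub>0 'r::{comm_ring,monoid_mult}"
  assumes "ideal_generated_by (range (Poly_Mapping.lookup f)) = UNIV"
  obtains a where "(\<Sum>x\<in>Poly_Mapping.keys f. a x * Poly_Mapping.lookup f x) = 1"
proof -
  let ?r = "Poly_Mapping.lookup f"
  define I where "I = range (\<lambda>a. \<Sum>x\<in>Poly_Mapping.keys f. a x * ?r x)"
  have "is_ideal I"
    unfolding is_ideal_def
  proof (intro conjI ballI allI)
    show "0 \<in> I"
      unfolding I_def by (rule range_eqI [of _ _ "\<lambda>_. 0"]) simp
  next
    fix b c
    assume "b \<in> I" "c \<in> I"
    then obtain a a' where "b = (\<Sum>x\<in>Poly_Mapping.keys f. a x * ?r x)"
      "c = (\<Sum>x\<in>Poly_Mapping.keys f. a' x * ?r x)"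
      unfolding I_def by blast
    then show "b + c \<in> I"
      unfolding I_def
      by (intro range_eqI [of _ _ "\<lambda>x. a x + a' x"]) (simp add: distrib_right sum.distrib)
  next
    fix b c
    assume "b \<in> I"
    then obtain a where "b = (\<Sum>x\<in>Poly_Mapping.keys f. a x * ?r x)"
      unfolding I_def by blast
    then show "c * b \<in> I"
      unfolding I_def
      by (intro range_eqI [of _ _ "\<lambda>x. c * a x"]) (simp add: sum_distrib_left mult.assoc)
  qed
  moreover have "?r y \<in> I" for y
    unfolding I_def
    \<comment> \<open>For \<open>y\<close> outside the support the combination is empty, and
      \<open>?r y\<close> is \<open>0\<close> as well.\<close>
    by (rule range_eqI [of _ _ "\<lambda>x. if x = y then 1 else 0"])
      (simp add: if_distrib [where f = "\<lambda>a. a * _"] in_keys_iff cong: if_cong)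
  ultimately have "ideal_generated_by (range ?r) \<subseteq> I"
    unfolding ideal_generated_by_def by blast
  then have "1 \<in> I" using assms by auto
  then show thesis
    using that unfolding I_def by force
qed

lemma unit_if:
  fixes f :: "'g::ab_group_add \<Rightarrow>\<^sub>0 'r::{comm_ring,monoid_mult}"
  assumes gen: "ideal_generated_by (range (Poly_Mapping.lookup f)) = UNIV"
    and nil: "\<And>x y. x \<noteq> y \<Longrightarrow> nilpotent (Poly_Mapping.lookup f x * Poly_Mapping.lookup f y)"
  shows "f \<in> group_ring_units"
proof -
  let ?r = "Poly_Mapping.lookup f" and ?K = "Poly_Mapping.keys f"
  obtain a where one: "(\<Sum>x\<in>?K. a x * ?r x) = 1"
    using ideal_generated_by_lookup_UNIV [OF gen] by blast
  define g where "g = (\<Sum>x\<in>?K. Poly_Mapping.single (- x) (a x * a x * ?r x))"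
  \<comment> \<open>\<open>g\<close> inverts \<open>f\<close> up to the error \<open>d\<close>. Once
    the coefficients of \<open>d\<close> are nilpotent, \<open>f * g\<close> is a unit and so is its
    factor \<open>f\<close>.\<close>
  define d where "d = f * g - group_ring_one"
  have fg: "Poly_Mapping.lookup (f * g) k = (\<Sum>x\<in>?K. a x * a x * (?r x * ?r (k + x)))" for k
    by (subst mult.commute)
      (simp add: g_def sum_distrib_right lookup_sum lookup_single_mult mult.assoc)
  have "nilpotent (Poly_Mapping.lookup d k)" for k
  proof (cases "k = 0")
    case False
    have "nilpotent (Poly_Mapping.lookup (f * g) k)"
      unfolding fg by (rule nilpotent_sum, rule nilpotent_mult) (use nil False in simp)
    then show ?thesis
      using False by (simp add: d_def lookup_minus group_ring_one_def lookup_single)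
  next
    case True
    let ?e = "\<lambda>x. a x * ?r x"
    \<comment> \<open>At \<open>0\<close> the product \<open>f * g\<close> has coefficient
      \<open>\<Sum>x\<in>?K. ?e x * ?e x\<close>, and the subtracted \<open>1\<close> is rewritten
      as the sum of the \<open>?e x\<close>.\<close>
    have "Poly_Mapping.lookup d k = (\<Sum>x\<in>?K. ?e x * ?e x) - (\<Sum>x\<in>?K. ?e x)"
      unfolding one using True fg [of 0]
      by (simp add: d_def lookup_minus group_ring_one_def ac_simps)
    also have "\<dots> = (\<Sum>x\<in>?K. - (\<Sum>y\<in>?K - {x}. ?e x * ?e y))"
      unfolding sum_subtractf [symmetric]
    proof (rule sum.cong)
      fix x
      assume "x \<in> ?K"
      \<comment> \<open>Replacing \<open>1\<close> by the sum of all \<open>?e y\<close> turns the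
        failure of idempotence into products over distinct indices.\<close>
      have "?e x * ?e x - ?e x = ?e x * ?e x - ?e x * (\<Sum>y\<in>?K. ?e y)"
        by (simp add: one)
      also have "\<dots> = - (\<Sum>y\<in>?K - {x}. ?e x * ?e y)"
        using \<open>x \<in> ?K\<close> by (simp add: sum.remove [of ?K x] sum_distrib_left distrib_left)
      finally show "?e x * ?e x - ?e x = - (\<Sum>y\<in>?K - {x}. ?e x * ?e y)" .
    qed simp
    also have "nilpotent \<dots>"
    proof (intro nilpotent_sum nilpotent_minus)
      fix x y
      assume "y \<in> ?K - {x}"
      then have "nilpotent ((a x * a y) * (?r x * ?r y))"
        using nil [of x y] by (auto intro: nilpotent_mult)
      then show "nilpotent (?e x * ?e y)" by (simp add: ac_simps)
    qed
    finally show ?thesis .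
  qed
  then have "group_ring_one + d \<in> group_ring_units"
    by (rule one_plus_nilpotent_coeffs_unit)
  then have "f * g \<in> group_ring_units"
    by (simp add: d_def)
  then show ?thesis
    by (simp add: group_ring_units_mult_iff)
qed

theorem theorem7p14:
  assumes "torsion_free TYPE('g::ab_group_add)"
  shows "(group_ring_units :: ('g \<Rightarrow>\<^sub>0 'r::{comm_ring,monoid_mult}) set) =
    {f. ideal_generated_by (range (Poly_Mapping.lookup f)) = UNIV \<and>
        (\<forall>x y. x \<noteq> y \<longrightarrow> nilpotent (Poly_Mapping.lookup f x * Poly_Mapping.lookup f y))}"
  using unit_imp [OF assms] unit_if by blast

end
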